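(* For all integers $m\ge1$ and $k\ge0$, and $|x|<1$, $$\mathrm{Hl}^m_{-k}(x)=\sum_{j=1}^m\binom{m}{j}(-1)^{j+1}\left(\mathrm{Hl}^{m-j}_{j-k}(x)+\sum_{l=0}^k\binom{k}{l}\mathrm{Li}_{l-k}(x)\,\mathrm{Hl}^{m-j}_{j-l}(x)\right).$$
   Context: $H_n=1+\frac12+\cdots+\frac1n$. For integers $m\ge0$ and $s\in\mathbb{C}$, the harmonic polylogarithm is $\mathrm{Hl}^m_s(x)=\sum_{n\ge1}H_n^m n^{-s}x^n$ ($|x|<1$); in particular $\mathrm{Hl}^0_s(x)=\mathrm{Li}_s(x)=\sum_{n\ge1}x^n n^{-s}$ is the polylogarithm. *)

theory Defs
  imports "HOL-Analysis.Analysis"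
begin

text \<open>
  Both series start at $n = 1$, hence the shift to \<^term>\<open>Suc n\<close>. Powers of a positive integer with
  complex exponent use the principal branch of \<^const>\<open>powr\<close>.
\<close>

definition Hl :: "nat \<Rightarrow> complex \<Rightarrow> complex \<Rightarrow> complex" where
  "Hl m s x = (\<Sum>n. harm (Suc n) ^ m * of_nat (Suc n) powr (- s) * x ^ Suc n)"

definition Li :: "complex \<Rightarrow> complex \<Rightarrow> complex" where
  "Li s x = (\<Sum>n. of_nat (Suc n) powr (- s) * x ^ Suc n)"

lemma Hl_0_left: "Hl 0 s x = Li s x"
  by (simp add: Hl_def Li_def)

lemma norm_harm_le: "norm (harm (Suc n) :: complex) \<le> real (Suc n)"
proof -
  have "norm (harm (Suc n) :: complex) \<le> (\<Sum>k=1..Suc n. 1)"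
    unfolding harm_def
    by (rule sum_norm_le) (auto simp: norm_inverse inverse_le_1_iff)
  then show ?thesis by simp
qed

lemma summable_Hl:
  fixes x s :: complex
  assumes "norm x < 1"
  shows "summable (\<lambda>n. harm (Suc n) ^ m * of_nat (Suc n) powr (- s) * x ^ Suc n)"
proof -
  obtain p where p: "\<bar>Re s\<bar> \<le> real p"
    using real_arch_simple by blast
  define N where "N = m + p"
  have "summable (\<lambda>n. of_nat n ^ N * of_real (norm x) ^ n :: real)"
  proof (cases "x = 0")
    case True
    then show ?thesis
      by (intro summable_finite[of "{0}"]) auto
  next
    case False
    define r where "r = (norm x + 1) / 2"
    have r: "norm x < r" "r < 1" using assms by (auto simp: r_def)
    have "(\<lambda>n. norm x * (1 + 1 / real n) ^ N) \<longlonglongrightarrow> norm x * (1 + 0) ^ N"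
      by (intro tendsto_intros lim_1_over_n)
    then have "eventually (\<lambda>n. norm x * (1 + 1 / real n) ^ N < r) sequentially"
      using r by (intro order_tendstoD(2)) auto
    then have "eventually (\<lambda>n. n > 0 \<and> norm x * (1 + 1 / real n) ^ N < r) sequentially"
      using eventually_gt_at_top[of 0] by eventually_elim simp
    then obtain M where M: "\<And>n. n \<ge> M \<Longrightarrow> n > 0 \<and> norm x * (1 + 1 / real n) ^ N < r"
      unfolding eventually_sequentially by blast
    show ?thesis
    proof (rule summable_ratio_test[OF r(2), of M])
      fix n assume n: "n \<ge> M"
      then have "n > 0" and le: "norm x * (1 + 1 / real n) ^ N \<le> r"
        using M by (auto intro: less_imp_le)
      have "real (Suc n) ^ N = real n ^ N * (1 + 1 / real n) ^ N"
        using \<open>n > 0\<close> by (simp add: power_mult_distrib[symmetric] field_simps)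
      then have "real (Suc n) ^ N * norm x ^ Suc n =
          (norm x * (1 + 1 / real n) ^ N) * (real n ^ N * norm x ^ n)"
        by (simp add: mult_ac)
      also have "\<dots> \<le> r * (real n ^ N * norm x ^ n)"
        by (intro mult_right_mono le) auto
      finally show "norm (of_nat (Suc n) ^ N * of_real (norm x) ^ Suc n :: real)
          \<le> r * norm (of_nat n ^ N * of_real (norm x) ^ n :: real)"
        by (simp add: abs_mult del: of_nat_Suc)
    qed
  qed
  then have "summable (\<lambda>n. real (Suc n) ^ N * norm x ^ Suc n)"
    by (subst (asm) summable_Suc_iff[symmetric]) simp
  then show ?thesis
  proof (rule summable_comparison_test')
    fix n :: nat
    have "norm (of_nat (Suc n) powr (- s) :: complex) = real (Suc n) powr (- Re s)"
      by (subst norm_powr_real_powr) (auto intro: Reals_of_nat)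
    also have "\<dots> \<le> real (Suc n) powr real p"
      using p by (intro powr_mono) auto
    also have "\<dots> = real (Suc n) ^ p"
      by (intro powr_realpow) auto
    finally have "norm (of_nat (Suc n) powr (- s) :: complex) \<le> real (Suc n) ^ p" .
    moreover have "norm (harm (Suc n) :: complex) ^ m \<le> real (Suc n) ^ m"
      by (intro power_mono norm_harm_le) auto
    ultimately have "norm (harm (Suc n) ^ m :: complex) * norm (of_nat (Suc n) powr (- s) :: complex)
        \<le> real (Suc n) ^ m * real (Suc n) ^ p"
      by (intro mult_mono) (auto simp: norm_power)
    then show "norm (harm (Suc n) ^ m * of_nat (Suc n) powr (- s) * x ^ Suc n)
        \<le> real (Suc n) ^ N * norm x ^ Suc n"
      unfolding norm_mult N_def power_add norm_power
      by (intro mult_right_mono) auto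
  qed
qed

end

theory Submission
  imports Defs
begin

text \<open>
  For \<open>m \<ge> 1\<close> the power \<open>H\<^sub>N\<^sup>m\<close> telescopes into the differences
  \<open>d\<^sub>n = H\<^sub>n\<^sup>m - (H\<^sub>n - 1/n)\<^sup>m\<close>, \<open>1 \<le> n \<le> N\<close>, which the binomial theorem expands in powers of \<open>1/n\<close>.
  Summing \<open>N\<^sup>k x\<^sup>N\<close> against these partial sums, the diagonal \<open>n = N\<close> gives the first group of terms;
  off the diagonal one writes \<open>N = n + i\<close> with \<open>i \<ge> 1\<close>, expands \<open>(n + i)\<^sup>k\<close>, and
  recognises for each \<open>l\<close> a Cauchy product of \<open>\<Sum> d\<^sub>n n\<^sup>l x\<^sup>n\<close> with \<open>Li\<^sub>l\<^sub>-\<^sub>k(x)\<close>.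
\<close>

text \<open>The norms of the terms are again terms of such a series, with \<open>Re s\<close> and
  \<open>norm x\<close> in place of \<open>s\<close> and \<open>x\<close>, because harmonic numbers
  are nonnegative reals. Absolute convergence is what the Cauchy products below require.\<close>

lemma summable_norm_Hl:
  fixes x s :: complex
  assumes "norm x < 1"
  shows "summable (\<lambda>n. norm (harm (Suc n) ^ m * of_nat (Suc n) powr (- s) * x ^ Suc n))"
proof -
  have eq: "harm (Suc n) ^ m * of_nat (Suc n) powr (- complex_of_real (Re s)) * complex_of_real (norm x) ^ Suc n
      = complex_of_real (norm (harm (Suc n) ^ m * of_nat (Suc n) powr (- s) * x ^ Suc n))" for n
  proof -
    have "norm (of_nat (Suc n) powr (- s) :: complex) = real (Suc n) powr (- Re s)"
      by (subst norm_powr_real_powr) (auto intro: Reals_of_nat)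
    moreover have "of_nat (Suc n) powr (- complex_of_real (Re s)) = complex_of_real (real (Suc n) powr (- Re s))"
      by (subst powr_of_real[symmetric]) auto
    moreover have "norm (harm (Suc n) :: complex) = harm (Suc n)"
      by (rule norm_harm)
    ultimately show ?thesis
      by (simp add: norm_mult norm_power of_real_harm del: of_nat_Suc power_Suc)
  qed
  have "summable (\<lambda>n. complex_of_real (norm (harm (Suc n) ^ m * of_nat (Suc n) powr (- s) * x ^ Suc n)))"
    unfolding eq[symmetric] using assms by (intro summable_Hl) simp
  then show ?thesis
    by (simp only: summable_complex_of_real)
qed

lemma Hl_sums:
  assumes "norm x < 1"
  shows "(\<lambda>n. harm (Suc n) ^ m * of_nat (Suc n) powr (- s) * x ^ Suc n) sums Hl m s x"
  unfolding Hl_def using assms by (intro summable_sums summable_Hl)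

lemma Suc_powr_nat_diff:
  "(of_nat (Suc n) :: complex) powr (- (of_nat j - of_nat l)) = of_nat (Suc n) ^ l / of_nat (Suc n) ^ j"
proof -
  have "(of_nat (Suc n) :: complex) powr (of_nat l - of_nat j) = of_nat (Suc n) ^ l / of_nat (Suc n) ^ j"
    unfolding powr_diff by (simp add: powr_nat' del: of_nat_Suc)
  then show ?thesis by simp
qed

text \<open>Harmonic numbers enter only later, through the choice of \<open>d\<close>; the splitting
  into diagonal and off-diagonal terms works for any absolutely summable weights.\<close>

lemma partial_sum_power_series_sums:
  fixes d :: "nat \<Rightarrow> complex"
  assumes d: "\<And>l. summable (\<lambda>n. norm (d n * of_nat (Suc n) ^ l * x ^ Suc n))"
    and x: "norm x < 1"
  defines "S \<equiv> \<lambda>l. \<Sum>n. d n * of_nat (Suc n) ^ l * x ^ Suc n"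
  shows "(\<lambda>N. (\<Sum>n\<le>N. d n) * of_nat (Suc N) ^ k * x ^ Suc N) sums
    (S k + (\<Sum>l=0..k. of_nat (k choose l) * Li (of_nat l - of_nat k) x * S l))"
proof -
  \<comment> \<open>For \<open>l \<le> k\<close> these are the terms of the polylogarithm; the
    natural exponent \<open>k - l\<close> is the form that the binomial theorem produces.\<close>
  define b where "b l i = of_nat (Suc i) ^ (k - l) * x ^ Suc i" for l i
  have b_eq: "b l i = harm (Suc i) ^ 0 * of_nat (Suc i) powr (- (of_nat l - of_nat k)) * x ^ Suc i"
    if "l \<le> k" for l i
    unfolding Suc_powr_nat_diff b_def using that by (simp add: power_diff del: of_nat_Suc)
  have b_summable: "summable (\<lambda>i. norm (b l i))" if "l \<le> k" for l
    unfolding b_eq[OF that] by (rule summable_norm_Hl[OF x])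
  have b_suminf: "suminf (b l) = Li (of_nat l - of_nat k) x" if "l \<le> k" for l
    unfolding b_eq[OF that] Hl_0_left[symmetric] Hl_def ..
  define a where "a l n = d n * of_nat (Suc n) ^ l * x ^ Suc n" for l n
  have "(\<lambda>M. \<Sum>l=0..k. of_nat (k choose l) * (\<Sum>n\<le>M. a l n * b l (M - n))) sums
      (\<Sum>l=0..k. of_nat (k choose l) * (S l * Li (of_nat l - of_nat k) x))"
  proof (intro sums_sum sums_mult)
    fix l assume "l \<in> {0..k}"
    then have l: "l \<le> k" by simp
    have "(\<lambda>M. \<Sum>n\<le>M. a l n * b l (M - n)) sums (suminf (a l) * suminf (b l))"
      by (rule Cauchy_product_sums) (use d b_summable[OF l] in \<open>simp_all add: a_def\<close>)
    then show "(\<lambda>M. \<Sum>n\<le>M. a l n * b l (M - n)) sums (S l * Li (of_nat l - of_nat k) x)"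
      using b_suminf[OF l] by (simp add: S_def a_def[abs_def])
  qed
  \<comment> \<open>Both factors are indexed from zero but start at exponent 1, so the product at
    index \<open>M\<close> carries \<open>Suc n + Suc (M - n) = M + 2\<close>.\<close>
  also have "(\<lambda>M. \<Sum>l=0..k. of_nat (k choose l) * (\<Sum>n\<le>M. a l n * b l (M - n))) =
      (\<lambda>M. (\<Sum>n<Suc M. d n) * of_nat (Suc (Suc M)) ^ k * x ^ Suc (Suc M))"
  proof
    fix M
    have "(\<Sum>l=0..k. of_nat (k choose l) * (\<Sum>n\<le>M. a l n * b l (M - n))) =
        (\<Sum>n\<le>M. \<Sum>l=0..k. of_nat (k choose l) * (a l n * b l (M - n)))"
      unfolding sum_distrib_left by (rule sum.swap)
    also have "\<dots> = (\<Sum>n\<le>M. d n * of_nat (Suc (Suc M)) ^ k * x ^ Suc (Suc M))"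
    proof (rule sum.cong[OF refl])
      fix n assume "n \<in> {..M}"
      then have n: "Suc (Suc M) = Suc n + Suc (M - n)" by simp
      have "(\<Sum>l=0..k. of_nat (k choose l) * (a l n * b l (M - n))) =
          d n * (\<Sum>l\<le>k. of_nat (k choose l) * of_nat (Suc n) ^ l * of_nat (Suc (M - n)) ^ (k - l)) *
            (x ^ Suc n * x ^ Suc (M - n))"
        unfolding sum_distrib_left sum_distrib_right atMost_atLeast0
        by (rule sum.cong) (simp_all add: a_def b_def mult_ac del: of_nat_Suc power_Suc)
      then show "(\<Sum>l=0..k. of_nat (k choose l) * (a l n * b l (M - n))) =
          d n * of_nat (Suc (Suc M)) ^ k * x ^ Suc (Suc M)"
        unfolding n power_add of_nat_add binomial_ring .
    qed
    finally show "(\<Sum>l=0..k. of_nat (k choose l) * (\<Sum>n\<le>M. a l n * b l (M - n))) =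
        (\<Sum>n<Suc M. d n) * of_nat (Suc (Suc M)) ^ k * x ^ Suc (Suc M)"
      unfolding sum_distrib_right lessThan_Suc_atMost .
  qed
  \<comment> \<open>Shifting the index down by one adds only the term at \<open>N = 0\<close>, which
    vanishes as an empty sum.\<close>
  finally have "(\<lambda>N. (\<Sum>n<N. d n) * of_nat (Suc N) ^ k * x ^ Suc N) sums
      (\<Sum>l=0..k. of_nat (k choose l) * (S l * Li (of_nat l - of_nat k) x))"
    by (subst (asm) sums_Suc_iff) simp
  moreover have "(\<lambda>n. d n * of_nat (Suc n) ^ k * x ^ Suc n) sums S k"
    unfolding S_def using summable_norm_cancel[OF d] by (rule summable_sums)
  ultimately have "(\<lambda>N. d N * of_nat (Suc N) ^ k * x ^ Suc N + (\<Sum>n<N. d n) * of_nat (Suc N) ^ k * x ^ Suc N) sums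
      (S k + (\<Sum>l=0..k. of_nat (k choose l) * (S l * Li (of_nat l - of_nat k) x)))"
    by (intro sums_add)
  then show ?thesis
    by (simp add: lessThan_Suc_atMost[symmetric] algebra_simps del: of_nat_Suc power_Suc)
qed

theorem theorem11:
  fixes m k :: nat and x :: complex
  assumes "m \<ge> 1" and "norm x < 1"
  shows "Hl m (- of_nat k) x =
    (\<Sum>j=1..m. of_nat (m choose j) * (- 1) ^ (j + 1) *
      (Hl (m - j) (of_nat j - of_nat k) x +
       (\<Sum>l=0..k. of_nat (k choose l) * Li (of_nat l - of_nat k) x *
          Hl (m - j) (of_nat j - of_nat l) x)))"
proof -
  define c :: "nat \<Rightarrow> complex" where "c j = of_nat (m choose j) * (- 1) ^ (j + 1)" for j
  define d :: "nat \<Rightarrow> complex"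
    where "d n = (\<Sum>j=1..m. c j * (harm (Suc n) ^ (m - j) / of_nat (Suc n) ^ j))" for n
  have d_eq: "d n = harm (Suc n) ^ m - harm n ^ m" for n
  proof -
    have "harm n = - (1 / of_nat (Suc n)) + (harm (Suc n) :: complex)"
      by (simp add: harm_Suc field_simps del: of_nat_Suc)
    then have "harm n ^ m =
        (\<Sum>j\<le>m. of_nat (m choose j) * (- (1 / of_nat (Suc n))) ^ j * (harm (Suc n) :: complex) ^ (m - j))"
      by (simp only: binomial_ring)
    \<comment> \<open>The sign in \<open>c\<close> absorbs the minus of the expansion. Since
      \<open>c 0 = -1\<close>, the term \<open>j = 0\<close> is \<open>harm (Suc n) ^ m\<close>, and
      the others add up to \<open>- d n\<close>.\<close>
    also have "\<dots> = (\<Sum>j\<le>m. - (c j * (harm (Suc n) ^ (m - j) / of_nat (Suc n) ^ j)))"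
      by (rule sum.cong[OF refl])
        (simp add: c_def power_minus[of "1 / _"] power_one_over divide_simps del: of_nat_Suc)
    also have "{..m} = insert 0 {1..m}" by auto
    also have "(\<Sum>j\<in>insert 0 {1..m}. - (c j * (harm (Suc n) ^ (m - j) / of_nat (Suc n) ^ j))) = harm (Suc n) ^ m - d n"
      by (simp add: c_def d_def sum_negf)
    finally show ?thesis by simp
  qed
  \<comment> \<open>The telescoping sum starts from \<open>harm 0 ^ m\<close>, which is 0 because
    \<open>m \<ge> 1\<close>.\<close>
  have harm_power: "(\<Sum>n\<le>N. d n) = harm (Suc N) ^ m" for N
    using assms(1) by (induction N) (simp_all add: d_eq harm_expand(1))
  have d_term: "d n * of_nat (Suc n) ^ l * x ^ Suc n =
      (\<Sum>j=1..m. c j * (harm (Suc n) ^ (m - j) * of_nat (Suc n) powr (- (of_nat j - of_nat l)) * x ^ Suc n))"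
    for n l
    unfolding d_def Suc_powr_nat_diff sum_distrib_right
    by (rule sum.cong) (simp_all del: of_nat_Suc)
  have d_summable: "summable (\<lambda>n. norm (d n * of_nat (Suc n) ^ l * x ^ Suc n))" for l
  proof (rule summable_comparison_test')
    show "summable (\<lambda>n. \<Sum>j=1..m. norm (c j) *
        norm (harm (Suc n) ^ (m - j) * of_nat (Suc n) powr (- (of_nat j - of_nat l)) * x ^ Suc n))"
      by (intro summable_sum summable_mult summable_norm_Hl assms)
    show "norm (norm (d n * of_nat (Suc n) ^ l * x ^ Suc n)) \<le> (\<Sum>j=1..m. norm (c j) *
        norm (harm (Suc n) ^ (m - j) * of_nat (Suc n) powr (- (of_nat j - of_nat l)) * x ^ Suc n))"
      if "n \<ge> 0" for n
      unfolding d_term norm_mult[symmetric, of "c _"] by (simp add: norm_sum del: of_nat_Suc power_Suc)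
  qed
  have d_suminf: "(\<Sum>n. d n * of_nat (Suc n) ^ l * x ^ Suc n) =
      (\<Sum>j=1..m. c j * Hl (m - j) (of_nat j - of_nat l) x)" for l
    unfolding d_term
    by (rule sums_unique[symmetric]) (intro sums_sum sums_mult Hl_sums assms)
  \<comment> \<open>The case \<open>j = 0\<close> of \<open>Suc_powr_nat_diff\<close> turns the
    complex power into \<open>of_nat (Suc N) ^ k\<close>.\<close>
  have "Hl m (- of_nat k) x = (\<Sum>N. (\<Sum>n\<le>N. d n) * of_nat (Suc N) ^ k * x ^ Suc N)"
    unfolding Hl_def harm_power using Suc_powr_nat_diff[of _ 0 k] by simp
  also have "\<dots> = (\<Sum>j=1..m. c j * Hl (m - j) (of_nat j - of_nat k) x) +
      (\<Sum>l=0..k. of_nat (k choose l) * Li (of_nat l - of_nat k) x *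
        (\<Sum>j=1..m. c j * Hl (m - j) (of_nat j - of_nat l) x))"
    using partial_sum_power_series_sums[OF d_summable assms(2)]
    unfolding d_suminf by (rule sums_unique[symmetric])
  also have "(\<Sum>l=0..k. of_nat (k choose l) * Li (of_nat l - of_nat k) x *
        (\<Sum>j=1..m. c j * Hl (m - j) (of_nat j - of_nat l) x)) =
      (\<Sum>j=1..m. c j * (\<Sum>l=0..k. of_nat (k choose l) * Li (of_nat l - of_nat k) x *
        Hl (m - j) (of_nat j - of_nat l) x))"
    unfolding sum_distrib_left by (subst sum.swap) (simp add: mult_ac)
  finally show ?thesis
    by (simp only: c_def distrib_left sum.distrib)
qed

end
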